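(* Let $\mathrm{d}$ be a diffuse Fredholm-nilpotent operator on a real Hilbert space $W$ with dense domain $V$, and let $V_h\subset V$ be a family of closed subspaces, parametrized by $h$, with $\mathrm{d}V_h\subset V_h$, equipped with projections $\pi_h$ onto $V_h$ that are defined and bounded on $W$, uniformly in $h$, and satisfy $\pi_h\mathrm{d}=\mathrm{d}\pi_h$ on $V$. Then there is a constant $C>0$, independent of $h$ and $f$, such that for every $f\in W$ and every $h$: if $(u,p)\in V\times\mathfrak{H}$ solves $$\langle \mathrm{d}u,v\rangle+\langle u,\mathrm{d}v\rangle+\langle p,v\rangle=\langle f,v\rangle\ \ \forall v\in V,\qquad \langle u,q\rangle=0\ \ \forall q\in\mathfrak{H},$$ and $(u_h,p_h)\in V_h\times\mathfrak{H}_h$ solves $$\langle \mathrm{d}u_h,v_h\rangle+\langle u_h,\mathrm{d}v_h\rangle+\langle p_h,v_h\rangle=\langle f,v_h\rangle\ \ \forall v_h\in V_h,\qquad \langle u_h,q_h\rangle=0\ \ \forall q_h\in\mathfrak{H}_h,$$ then $$\|\mathrm{d}(u-u_h)\|\le C\,E(\mathrm{d}u).$$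
   Context: $W$ has inner product $\langle\cdot,\cdot\rangle$ and norm $\|\cdot\|$. A closed, densely defined linear operator $\mathrm{d}$ on $W$ with domain $V=\mathcal{D}(\mathrm{d})$ is nilpotent if its range is contained in its kernel (so $\mathrm{d}^2=0$); it is diffuse Fredholm-nilpotent if in addition its range is closed, its range has finite codimension in its kernel, and $\mathcal{D}(\mathrm{d})\cap\ker(\mathrm{d})^\perp$ (with the graph norm) is compactly included in $\ker(\mathrm{d})^\perp$. $V$ carries the graph inner product $\langle u,v\rangle_V=\langle u,v\rangle+\langle \mathrm{d}u,\mathrm{d}v\rangle$. Set $\mathfrak{Z}=\ker\mathrm{d}$, $\mathfrak{B}=\operatorname{range}\mathrm{d}$, $\mathfrak{H}=\mathfrak{Z}\cap\mathfrak{B}^{\perp_W}$, where $\perp_W$ is the orthogonal complement in $W$. "Projection $\pi_h$ onto $V_h$" means linear, idempotent, with range $V_h$ (not necessarily orthogonal). For $\mathrm{d}_h=\mathrm{d}|_{V_h}$ put $\mathfrak{Z}_h=\ker\mathrm{d}_h$, $\mathfrak{B}_h=\mathrm{d}V_h$, $\mathfrak{H}_h=\{z\in\mathfrak{Z}_h:\langle z,b\rangle=0\ \forall b\in\mathfrak{B}_h\}$. For $w\in W$, $E(w)=\inf_{v_h\in V_h}\|w-v_h\|$. *)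

theory Defs
  imports "HOL-Analysis.Analysis"
begin

text \<open>
  A partially defined operator on a Hilbert space is given by a pair of a total function
  \<open>d\<close> and its domain \<open>V\<close>; the values of \<open>d\<close> outside \<open>V\<close> carry no meaning.
  The restriction of \<open>d\<close> to a smaller subspace \<open>V\<^sub>h\<close> is the pair of \<open>d\<close> and \<open>V\<^sub>h\<close>.
\<close>

definition linear_operator_on :: "('a::real_vector \<Rightarrow> 'a) \<Rightarrow> 'a set \<Rightarrow> bool" where
  "linear_operator_on d V \<longleftrightarrow>
     subspace V \<and> (\<forall>u\<in>V. \<forall>v\<in>V. d (u + v) = d u + d v) \<and> (\<forall>c. \<forall>u\<in>V. d (c *\<^sub>R u) = c *\<^sub>R d u)"

definition closed_operator :: "('a::real_normed_vector \<Rightarrow> 'a) \<Rightarrow> 'a set \<Rightarrow> bool" where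
  "closed_operator d V \<longleftrightarrow> closed {(v, d v) | v. v \<in> V}"

definition densely_defined :: "'a::topological_space set \<Rightarrow> bool" where
  "densely_defined V \<longleftrightarrow> closure V = UNIV"

definition kernel_on :: "('a::zero \<Rightarrow> 'a) \<Rightarrow> 'a set \<Rightarrow> 'a set" where
  "kernel_on d V = {v \<in> V. d v = 0}"

definition range_on :: "('a \<Rightarrow> 'a) \<Rightarrow> 'a set \<Rightarrow> 'a set" where
  "range_on d V = d ` V"

definition harmonic_on :: "('a::real_inner \<Rightarrow> 'a) \<Rightarrow> 'a set \<Rightarrow> 'a set" where
  "harmonic_on d V = kernel_on d V \<inter> orthogonal_comp (range_on d V)"

definition graph_inner :: "('a::real_inner \<Rightarrow> 'a) \<Rightarrow> 'a \<Rightarrow> 'a \<Rightarrow> real" where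
  "graph_inner d u v = inner u v + inner (d u) (d v)"

definition graph_norm :: "('a::real_inner \<Rightarrow> 'a) \<Rightarrow> 'a \<Rightarrow> real" where
  "graph_norm d v = sqrt (graph_inner d v v)"

definition graph_closed_in :: "('a::real_inner \<Rightarrow> 'a) \<Rightarrow> 'a set \<Rightarrow> 'a set \<Rightarrow> bool" where
  "graph_closed_in d V S \<longleftrightarrow> S \<subseteq> V \<and>
     (\<forall>x. \<forall>l\<in>V. (\<forall>n. x n \<in> S) \<and> (\<lambda>n::nat. graph_norm d (x n - l)) \<longlonglongrightarrow> 0 \<longrightarrow> l \<in> S)"

definition finite_codim_in :: "'a::real_vector set \<Rightarrow> 'a set \<Rightarrow> bool" where
  "finite_codim_in B Z \<longleftrightarrow> B \<subseteq> Z \<and> (\<exists>F. finite F \<and> F \<subseteq> Z \<and> Z \<subseteq> span (B \<union> F))"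

text \<open>
  Compactness of the inclusion of \<open>X\<close>, with the graph norm, into the ambient space: sets that
  are bounded in the graph norm are relatively compact. If \<open>X\<close> lies in a closed subspace,
  the closures taken in that subspace and in the ambient space are the same.
\<close>

definition graph_compactly_included :: "('a::real_inner \<Rightarrow> 'a) \<Rightarrow> 'a set \<Rightarrow> bool" where
  "graph_compactly_included d X \<longleftrightarrow>
     (\<forall>S\<subseteq>X. (\<exists>b. \<forall>v\<in>S. graph_norm d v \<le> b) \<longrightarrow> compact (closure S))"

definition nilpotent_operator :: "('a::real_inner \<Rightarrow> 'a) \<Rightarrow> 'a set \<Rightarrow> bool" where
  "nilpotent_operator d V \<longleftrightarrow>
     linear_operator_on d V \<and> closed_operator d V \<and> densely_defined V \<and>
     range_on d V \<subseteq> kernel_on d V"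

definition diffuse_fredholm_nilpotent :: "('a::real_inner \<Rightarrow> 'a) \<Rightarrow> 'a set \<Rightarrow> bool" where
  "diffuse_fredholm_nilpotent d V \<longleftrightarrow>
     nilpotent_operator d V \<and>
     closed (range_on d V) \<and>
     finite_codim_in (range_on d V) (kernel_on d V) \<and>
     graph_compactly_included d (V \<inter> orthogonal_comp (kernel_on d V))"

definition projection_onto :: "('a::real_vector \<Rightarrow> 'a) \<Rightarrow> 'a set \<Rightarrow> bool" where
  "projection_onto P S \<longleftrightarrow> linear P \<and> (\<forall>w. P (P w) = P w) \<and> range P = S"

text \<open>
  Used with domain \<open>V\<close> for the continuous problem and with \<open>V\<^sub>h\<close> for the discrete one.
\<close>

definition hodge_dirac_solution ::
    "('a::real_inner \<Rightarrow> 'a) \<Rightarrow> 'a set \<Rightarrow> 'a \<Rightarrow> 'a \<Rightarrow> 'a \<Rightarrow> bool" where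
  "hodge_dirac_solution d V f u p \<longleftrightarrow>
     u \<in> V \<and> p \<in> harmonic_on d V \<and>
     (\<forall>v\<in>V. inner (d u) v + inner u (d v) + inner p v = inner f v) \<and>
     (\<forall>q\<in>harmonic_on d V. inner u q = 0)"

definition best_approx_error :: "'a::real_normed_vector set \<Rightarrow> 'a \<Rightarrow> real" where
  "best_approx_error S w = (INF s\<in>S. norm (w - s))"

end

theory Submission
  imports Defs
begin

text \<open>
  Testing both problems with \<open>v \<in> range_on d V\<^sub>h\<close> removes the other two terms on the left, so
  \<open>d u\<^sub>h\<close> is the \<open>W\<close>-orthogonal projection of \<open>d u\<close> onto \<open>range_on d V\<^sub>h\<close>. Since \<open>\<pi>\<^sub>h\<close> commutes
  with \<open>d\<close>, the element \<open>\<pi>\<^sub>h (d u) = d (\<pi>\<^sub>h u)\<close> is a competitor in that space, and bounded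
  projections are quasi-optimal, with constant \<open>1 + \<parallel>\<pi>\<^sub>h\<parallel>\<close>.
\<close>

lemma linear_operator_on_diff:
  assumes "linear_operator_on d V" and "u \<in> V" and "v \<in> V"
  shows "d (u - v) = d u - d v"
proof -
  have V: "subspace V" and add: "\<And>u v. u \<in> V \<Longrightarrow> v \<in> V \<Longrightarrow> d (u + v) = d u + d v"
    and scale: "\<And>c u. u \<in> V \<Longrightarrow> d (c *\<^sub>R u) = c *\<^sub>R d u"
    using assms(1) by (simp_all add: linear_operator_on_def)
  have "(-1) *\<^sub>R v \<in> V"
    using V assms(3) by (rule subspace_scale)
  then have "d (u + (-1) *\<^sub>R v) = d u + (-1) *\<^sub>R d v"
    by (simp only: add[OF assms(2)] scale[OF assms(3)])
  then show ?thesis by simp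
qed

text \<open>The harmonic part \<open>p\<close> is orthogonal to the range, and
  \<open>d b = 0\<close> kills the term \<open>inner u (d b)\<close>. The domain is left generic so
  that the lemma serves the continuous and the discrete problem alike.\<close>

lemma hodge_dirac_solution_inner_range:
  assumes sol: "hodge_dirac_solution d V f u p"
    and b: "b \<in> range_on d V" "b \<in> kernel_on d V"
  shows "inner (d u) b = inner f b"
proof -
  have "inner p b = 0"
    using sol b(1)
    by (auto simp: hodge_dirac_solution_def harmonic_on_def orthogonal_comp_def orthogonal_def
        inner_commute)
  moreover have "inner (d u) b + inner u (d b) + inner p b = inner f b"
    using sol b(2) unfolding hodge_dirac_solution_def kernel_on_def by blast
  ultimately show ?thesis
    using b(2) by (simp add: kernel_on_def)
qed

text \<open>Pythagoras for the splitting \<open>x - z = (x - y) + (y - z)\<close>.\<close>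

lemma norm_diff_le_if_orthogonal:
  fixes x y z :: "'a::real_inner"
  assumes "inner (x - y) (y - z) = 0"
  shows "norm (x - y) \<le> norm (x - z)"
proof -
  have "(norm (x - z))\<^sup>2 = (norm (x - y))\<^sup>2 + (norm (y - z))\<^sup>2"
    using norm_add_Pythagorean[of "x - y" "y - z"] assms by (simp add: orthogonal_def)
  then show ?thesis
    by (simp add: power2_le_imp_le)
qed

text \<open>Since \<open>P\<close> fixes \<open>S\<close>, the error \<open>w - P w\<close> is
  unchanged when \<open>w\<close> is replaced by \<open>w - s\<close>, which \<open>P\<close>
  enlarges by a factor of at most \<open>M\<close>.\<close>

lemma projection_onto_quasi_optimal:
  fixes P :: "'a::real_normed_vector \<Rightarrow> 'a"
  assumes P: "projection_onto P S" and bound: "\<And>w. norm (P w) \<le> M * norm w" and "0 \<le> M"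
  shows "norm (w - P w) \<le> (1 + M) * best_approx_error S w"
proof -
  \<comment> \<open>Dividing by \<open>1 + M\<close> leaves a lower bound independent of
    \<open>s\<close>, so it passes to the infimum.\<close>
  have "norm (w - P w) / (1 + M) \<le> norm (w - s)" if "s \<in> S" for s
  proof -
    have "P s = s"
      using P that unfolding projection_onto_def by blast
    moreover have "P (w - s) = P w - P s"
      using P by (simp add: projection_onto_def linear_diff)
    ultimately have "w - P w = (w - s) - P (w - s)" by simp
    then have "norm (w - P w) \<le> norm (w - s) + norm (P (w - s))"
      by (simp only: norm_triangle_ineq4)
    also have "\<dots> \<le> (1 + M) * norm (w - s)"
      using bound[of "w - s"] by (simp add: algebra_simps)
    finally show ?thesis
      using \<open>0 \<le> M\<close> by (simp add: divide_le_eq mult.commute)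
  qed
  moreover have "S \<noteq> {}"
    using P by (auto simp: projection_onto_def)
  ultimately have "norm (w - P w) / (1 + M) \<le> best_approx_error S w"
    unfolding best_approx_error_def by (intro cINF_greatest)
  then show ?thesis
    using \<open>0 \<le> M\<close> by (simp add: divide_le_eq mult.commute)
qed

theorem theorem3p6:
  fixes d :: "'a::{real_inner, complete_space} \<Rightarrow> 'a"
    and V :: "'a set"
    and H :: "'h set"
    and Vh :: "'h \<Rightarrow> 'a set"
    and \<pi> :: "'h \<Rightarrow> 'a \<Rightarrow> 'a"
  assumes "diffuse_fredholm_nilpotent d V"
    and "\<And>h. h \<in> H \<Longrightarrow> subspace (Vh h)"
    and "\<And>h. h \<in> H \<Longrightarrow> Vh h \<subseteq> V"
    and "\<And>h. h \<in> H \<Longrightarrow> graph_closed_in d V (Vh h)"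
    and "\<And>h. h \<in> H \<Longrightarrow> d ` Vh h \<subseteq> Vh h"
    and "\<And>h. h \<in> H \<Longrightarrow> projection_onto (\<pi> h) (Vh h)"
    and "\<exists>M. \<forall>h\<in>H. \<forall>w. norm (\<pi> h w) \<le> M * norm w"
    and "\<And>h v. h \<in> H \<Longrightarrow> v \<in> V \<Longrightarrow> \<pi> h (d v) = d (\<pi> h v)"
  shows "\<exists>C>0. \<forall>f. \<forall>h\<in>H. \<forall>u p uh ph.
           hodge_dirac_solution d V f u p \<longrightarrow>
           hodge_dirac_solution d (Vh h) f uh ph \<longrightarrow>
           norm (d (u - uh)) \<le> C * best_approx_error (Vh h) (d u)"
proof -
  obtain M0 where M0: "\<And>h w. h \<in> H \<Longrightarrow> norm (\<pi> h w) \<le> M0 * norm w"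
    using assms(7) by blast
  \<comment> \<open>The sign of \<open>M0\<close> is unknown; the absolute value ensures
    \<open>1 + M > 0\<close>.\<close>
  define M where "M = \<bar>M0\<bar>"
  have M: "norm (\<pi> h w) \<le> M * norm w" if "h \<in> H" for h w
    using order_trans[OF M0[OF that] mult_right_mono[OF abs_ge_self norm_ge_zero]]
    by (simp add: M_def)
  have lin: "linear_operator_on d V" and nil: "range_on d V \<subseteq> kernel_on d V"
    using assms(1) by (auto simp: diffuse_fredholm_nilpotent_def nilpotent_operator_def)
  have "norm (d (u - uh)) \<le> (1 + M) * best_approx_error (Vh h) (d u)"
    if h: "h \<in> H" and sol: "hodge_dirac_solution d V f u p"
      and solh: "hodge_dirac_solution d (Vh h) f uh ph" for f h u p uh ph
  proof -
    note VhV = assms(3)[OF h]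
    have u: "u \<in> V" and uh: "uh \<in> Vh h"
      using sol solh by (auto simp: hodge_dirac_solution_def)
    have \<pi>u: "\<pi> h u \<in> Vh h"
      using assms(6)[OF h] by (auto simp: projection_onto_def)
    \<comment> \<open>This is the preimage under \<open>d\<close> of the test function
      \<open>d uh - \<pi> h (d u)\<close>, by the commutation of \<open>\<pi> h\<close> with
      \<open>d\<close>.\<close>
    have "uh - \<pi> h u \<in> Vh h"
      using assms(2)[OF h] uh \<pi>u by (rule subspace_diff)
    moreover have "d (uh - \<pi> h u) = d uh - \<pi> h (d u)"
      using linear_operator_on_diff[OF lin, of uh "\<pi> h u"] uh \<pi>u VhV assms(8)[OF h u] by auto
    ultimately have b: "d uh - \<pi> h (d u) \<in> range_on d (Vh h)"
      unfolding range_on_def by (intro image_eqI[of _ _ "uh - \<pi> h u"]) simp_all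
    have bV: "d uh - \<pi> h (d u) \<in> range_on d V"
      using b VhV by (auto simp: range_on_def)
    then have bker: "d uh - \<pi> h (d u) \<in> kernel_on d V"
      using nil by (rule subsetD[rotated])
    \<comment> \<open>Invariance of \<open>Vh h\<close> under \<open>d\<close> makes the test
      function admissible in the discrete problem too.\<close>
    have "d uh - \<pi> h (d u) \<in> Vh h"
      using b assms(5)[OF h] unfolding range_on_def by (rule subsetD[rotated])
    then have bkerh: "d uh - \<pi> h (d u) \<in> kernel_on d (Vh h)"
      using bker by (simp add: kernel_on_def)
    \<comment> \<open>Galerkin orthogonality: both problems have the same right-hand side
      \<open>f\<close>, which cancels.\<close>
    have "inner (d u - d uh) (d uh - \<pi> h (d u)) = 0"
      using hodge_dirac_solution_inner_range[OF sol bV bker]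
        hodge_dirac_solution_inner_range[OF solh b bkerh]
      by (simp only: inner_diff_left diff_self)
    then have "norm (d u - d uh) \<le> norm (d u - \<pi> h (d u))"
      by (rule norm_diff_le_if_orthogonal)
    also have "\<dots> \<le> (1 + M) * best_approx_error (Vh h) (d u)"
      using assms(6)[OF h] M[OF h] by (rule projection_onto_quasi_optimal) (simp add: M_def)
    finally show ?thesis
      using linear_operator_on_diff[OF lin u] uh VhV by auto
  qed
  then show ?thesis
    by (intro exI[of _ "1 + M"]) (auto simp: M_def)
qed

end
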